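(* Let $b\ge 2$ and let $(\mathcal{P},\mathcal{B})$ be a $2$-$(v,b,1)$ design, i.e. $\mathcal{P}$ is a set of $v$ points and $\mathcal{B}$ is a family of $b$-element subsets of $\mathcal{P}$ (blocks) such that every pair of distinct points lies in exactly one block. Let $(\mathcal{P}',\mathcal{B}')$ be a $2$-$(v',b,1)$ subdesign, i.e. $\mathcal{P}'\subseteq\mathcal{P}$, $\mathcal{B}'\subseteq\mathcal{B}$, every block of $\mathcal{B}'$ is contained in $\mathcal{P}'$, and $(\mathcal{P}',\mathcal{B}')$ is a $2$-$(v',b,1)$ design. Let $p_1,p_2\in\mathcal{P}'$ be distinct. Let $C_1$ be the set of blocks of $\mathcal{B}'$ containing $p_1$ but not $p_2$, and $C_2$ the set of blocks of $\mathcal{B}'$ containing $p_2$ but not $p_1$. Let $\Gamma$ be the block graph of $(\mathcal{P},\mathcal{B})$. Then $\{C_1,C_2\}$ is a switching set of $\Gamma$.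
   Context: The block graph of a $2$-$(v,b,1)$ design has the blocks as vertices, two distinct blocks being adjacent iff they intersect. For a vertex $x$ of a graph $\Gamma$, $\Gamma(x)$ denotes its neighbourhood. For a finite simple graph $\Gamma$ with vertex set $V$ and disjoint subsets $C_1,C_2\subseteq V$, put $D=V\setminus(C_1\cup C_2)$. The pair $\{C_1,C_2\}$ is called a switching set of $\Gamma$ if: $|C_1|=|C_2|$; the induced subgraphs on $C_1$, on $C_2$ and on $C_1\cup C_2$ are regular, and the induced subgraphs on $C_1$ and on $C_2$ have the same degree; and every $x\in D$ satisfies $|\Gamma(x)\cap C_1|=|\Gamma(x)\cap C_2|$ or $\Gamma(x)\cap(C_1\cup C_2)\in\{C_1,C_2\}$. *)

theory Defs
  imports "Graph_Theory.Pair_Digraph" "Graph_Theory.Digraph_Component"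
begin

text \<open>\<open>steiner_design v b P Bs\<close>: \<open>(P, Bs)\<close> is a 2-\<open>(v, b, 1)\<close> design. Blocks form a set, not a
  multiset: for \<open>b \<ge> 2\<close> the condition on pairs of points rules out repeated blocks.\<close>

definition steiner_design :: "nat \<Rightarrow> nat \<Rightarrow> 'p set \<Rightarrow> 'p set set \<Rightarrow> bool" where
  "steiner_design v b P Bs \<longleftrightarrow>
     finite P \<and> card P = v \<and>
     (\<forall>B\<in>Bs. B \<subseteq> P \<and> card B = b) \<and>
     (\<forall>p\<in>P. \<forall>q\<in>P. p \<noteq> q \<longrightarrow> (\<exists>!B. B \<in> Bs \<and> p \<in> B \<and> q \<in> B))"

definition subdesign :: "nat \<Rightarrow> nat \<Rightarrow> 'p set \<Rightarrow> 'p set set \<Rightarrow> 'p set \<Rightarrow> 'p set set \<Rightarrow> bool" where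
  "subdesign v' b P' Bs' P Bs \<longleftrightarrow>
     P' \<subseteq> P \<and> Bs' \<subseteq> Bs \<and> (\<forall>B\<in>Bs'. B \<subseteq> P') \<and> steiner_design v' b P' Bs'"

definition block_graph :: "'p set set \<Rightarrow> ('p set, 'p set \<times> 'p set) pre_digraph" where
  "block_graph Bs = with_proj
     \<lparr> pverts = Bs, parcs = {(A, B). A \<in> Bs \<and> B \<in> Bs \<and> A \<noteq> B \<and> A \<inter> B \<noteq> {}} \<rparr>"

definition neighbourhood :: "('a, 'b) pre_digraph \<Rightarrow> 'a \<Rightarrow> 'a set" where
  "neighbourhood G x = {y. x \<rightarrow>\<^bsub>G\<^esub> y}"

text \<open>The empty graph is regular of every degree.\<close>

definition regular_of_degree :: "('a, 'b) pre_digraph \<Rightarrow> nat \<Rightarrow> bool" where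
  "regular_of_degree G k \<longleftrightarrow> (\<forall>x\<in>verts G. card (neighbourhood G x) = k)"

text \<open>The locale predicate \<^const>\<open>graph\<close> describes finite simple graphs, represented as symmetric
  digraphs. The definition is symmetric in \<open>C1\<close> and \<open>C2\<close>, so it is a property of the unordered
  pair.\<close>

definition switching_set :: "('a, 'b) pre_digraph \<Rightarrow> 'a set \<Rightarrow> 'a set \<Rightarrow> bool" where
  "switching_set G C1 C2 \<longleftrightarrow>
     graph G \<and> C1 \<subseteq> verts G \<and> C2 \<subseteq> verts G \<and> C1 \<inter> C2 = {} \<and>
     card C1 = card C2 \<and>
     (\<exists>k. regular_of_degree (G \<restriction> C1) k \<and> regular_of_degree (G \<restriction> C2) k) \<and>
     (\<exists>k. regular_of_degree (G \<restriction> (C1 \<union> C2)) k) \<and>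
     (\<forall>x \<in> verts G - (C1 \<union> C2).
        card (neighbourhood G x \<inter> C1) = card (neighbourhood G x \<inter> C2) \<or>
        neighbourhood G x \<inter> (C1 \<union> C2) \<in> {C1, C2})"

lemma neighbourhood_block_graph:
  "neighbourhood (block_graph Bs) A =
     {B. A \<in> Bs \<and> B \<in> Bs \<and> A \<noteq> B \<and> A \<inter> B \<noteq> {}}"
  by (auto simp: neighbourhood_def block_graph_def)

lemma graph_block_graph:
  assumes "finite Bs"
  shows "graph (block_graph Bs)"
proof -
  let ?G = "\<lparr> pverts = Bs, parcs = {(A, B). A \<in> Bs \<and> B \<in> Bs \<and> A \<noteq> B \<and> A \<inter> B \<noteq> {}} \<rparr>"
  have "finite (parcs ?G)"
    by (rule finite_subset[of _ "Bs \<times> Bs"]) (use assms in auto)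
  then have "pair_graph ?G"
    using assms by unfold_locales (auto simp: symmetric_def intro!: symI)
  then show ?thesis
    unfolding block_graph_def by (rule pair_graph.pair_graphD_graph)
qed

end

theory Submission
  imports Defs
begin

text \<open>Let \<open>L\<close> be the block through \<open>p1\<close> and \<open>p2\<close>, so that \<open>C1\<close> and \<open>C2\<close> are the pencils of
  \<open>p1\<close> and \<open>p2\<close> in the subdesign with \<open>L\<close> removed. Each pencil is a clique, and its blocks partition
  \<open>P' - L\<close> into sets of size \<open>b - 1\<close>. A block \<open>X\<close> of the large design missing \<open>p1\<close> meets exactly
  \<open>card (X \<inter> P' - L)\<close> members of \<open>C1\<close>, because each point of \<open>X \<inter> P' - L\<close> is joined to \<open>p1\<close> by its
  own block; this number does not depend on \<open>p1\<close>. Finally, a block containing \<open>p1\<close> but lying outside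
  the subdesign has no other point in \<open>P'\<close>, so among \<open>C1 \<union> C2\<close> it is adjacent precisely to \<open>C1\<close>.\<close>

lemma steiner_designD:
  assumes "steiner_design v b P Bs"
  shows "finite P" and "finite Bs"
    and "\<And>B. B \<in> Bs \<Longrightarrow> B \<subseteq> P" and "\<And>B. B \<in> Bs \<Longrightarrow> card B = b"
proof -
  show P: "finite P" and B: "\<And>B. B \<in> Bs \<Longrightarrow> B \<subseteq> P" and "\<And>B. B \<in> Bs \<Longrightarrow> card B = b"
    using assms by (auto simp: steiner_design_def)
  show "finite Bs"
    by (rule finite_subset[of _ "Pow P"]) (use P B in auto)
qed

lemma steiner_design_block_ex:
  assumes "steiner_design v b P Bs" "p \<in> P" "q \<in> P" "p \<noteq> q"
  obtains B where "B \<in> Bs" "p \<in> B" "q \<in> B"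
  using assms unfolding steiner_design_def by blast

lemma steiner_design_block_unique:
  assumes "steiner_design v b P Bs" "A \<in> Bs" "B \<in> Bs"
    and "p \<in> A" "q \<in> A" "p \<in> B" "q \<in> B" "p \<noteq> q"
  shows "A = B"
proof -
  have "p \<in> P" "q \<in> P" using assms by (auto simp: steiner_design_def)
  then show ?thesis using assms unfolding steiner_design_def by blast
qed

text \<open>The subdesign already joins \<open>p\<close> and \<open>q\<close> by a block of its own,
  and uniqueness in the large design identifies \<open>X\<close> with it.\<close>

lemma subdesign_block_mem:
  assumes "steiner_design v b P Bs" "subdesign v' b P' Bs' P Bs"
    and "X \<in> Bs" "p \<in> X" "q \<in> X" "p \<in> P'" "q \<in> P'" "p \<noteq> q"
  shows "X \<in> Bs'"
proof -
  have sub: "steiner_design v' b P' Bs'" "Bs' \<subseteq> Bs"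
    using assms(2) by (auto simp: subdesign_def)
  obtain B where "B \<in> Bs'" "p \<in> B" "q \<in> B"
    using steiner_design_block_ex[OF sub(1)] assms by metis
  then show ?thesis
    using steiner_design_block_unique[OF assms(1)] assms sub by blast
qed

text \<open>The right-hand side depends on \<open>L\<close> alone, so exchanging \<open>p\<close>
  and \<open>q\<close> compares the sizes of the two pencils.\<close>

lemma pencil_partition_card:
  assumes D: "steiner_design v b P Bs"
    and L: "L \<in> Bs" "p \<in> L" "q \<in> L" and "p \<noteq> q"
  shows "card {B \<in> Bs. p \<in> B \<and> q \<notin> B} * (b - 1) = card (P - L)"
proof -
  let ?C = "{B \<in> Bs. p \<in> B \<and> q \<notin> B}"
  note uniq = steiner_design_block_unique[OF D]
  note D' = steiner_designD[OF D]
  have p: "p \<in> P" using D'(3) L by blast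
  have "P - L \<subseteq> (\<Union>B\<in>?C. B - {p})"
  proof
    fix r assume r: "r \<in> P - L"
    then have "p \<noteq> r" using L by auto
    with r p obtain B where B: "B \<in> Bs" "p \<in> B" "r \<in> B"
      using steiner_design_block_ex[OF D, of p r] by blast
    \<comment> \<open>Otherwise \<open>B\<close> would share \<open>p\<close> and \<open>q\<close>
      with \<open>L\<close> and equal it, although \<open>r\<close> lies on \<open>B\<close> and off
      \<open>L\<close>.\<close>
    have "q \<notin> B" using uniq[of B L p q] B L r \<open>p \<noteq> q\<close> by blast
    with B \<open>p \<noteq> r\<close> show "r \<in> (\<Union>B\<in>?C. B - {p})" by blast
  qed
  moreover have "(\<Union>B\<in>?C. B - {p}) \<subseteq> P - L"
  proof
    fix r assume "r \<in> (\<Union>B\<in>?C. B - {p})"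
    then obtain B where B: "B \<in> Bs" "p \<in> B" "q \<notin> B" "r \<in> B" "r \<noteq> p" by blast
    then have "r \<notin> L" using uniq[of B L p r] L by blast
    with B D'(3) show "r \<in> P - L" by blast
  qed
  ultimately have "card (P - L) = card (\<Union>B\<in>?C. B - {p})" by (metis subset_antisym)
  also have "\<dots> = (\<Sum>B\<in>?C. card (B - {p}))"
  proof (rule card_UN_disjoint)
    show "finite ?C" using D'(2) by simp
    show "\<forall>B\<in>?C. finite (B - {p})"
      using D'(1,3) by (auto intro: finite_subset)
    show "\<forall>A\<in>?C. \<forall>B\<in>?C. A \<noteq> B \<longrightarrow> (A - {p}) \<inter> (B - {p}) = {}"
      using uniq by blast
  qed
  also have "\<dots> = (\<Sum>B\<in>?C. b - 1)"
    by (rule sum.cong) (auto simp: D'(4))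
  finally show ?thesis by simp
qed

text \<open>The bijection sends a point \<open>r\<close> of \<open>X\<close> in \<open>P'\<close>
  and off \<open>L\<close> to the subdesign block through \<open>p\<close> and \<open>r\<close>.
  Here \<open>X\<close> may be any block of the large design, inside or outside the
  subdesign.\<close>

lemma pencil_meeting_card:
  assumes D: "steiner_design v b P Bs" and S: "subdesign v' b P' Bs' P Bs"
    and L: "L \<in> Bs'" "p \<in> L" "q \<in> L" and "p \<noteq> q"
    and X: "X \<in> Bs" "p \<notin> X"
  shows "card {B \<in> Bs'. p \<in> B \<and> q \<notin> B \<and> X \<inter> B \<noteq> {}} = card (X \<inter> P' - L)"
proof -
  let ?C = "{B \<in> Bs'. p \<in> B \<and> q \<notin> B \<and> X \<inter> B \<noteq> {}}"
  have sub: "Bs' \<subseteq> Bs" and D': "steiner_design v' b P' Bs'"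
    using S by (auto simp: subdesign_def)
  note uniq = steiner_design_block_unique[OF D]
  have p: "p \<in> P'" using steiner_designD(3)[OF D'] L by blast
  have "\<forall>r\<in>X \<inter> P' - L. \<exists>B. B \<in> Bs' \<and> p \<in> B \<and> r \<in> B"
    using steiner_design_block_ex[OF D', of p] p L by blast
  then obtain f where f: "\<And>r. r \<in> X \<inter> P' - L \<Longrightarrow> f r \<in> Bs' \<and> p \<in> f r \<and> r \<in> f r"
    by metis
  have "inj_on f (X \<inter> P' - L)"
  proof (rule inj_onI, rule ccontr)
    fix r s assume rs: "r \<in> X \<inter> P' - L" "s \<in> X \<inter> P' - L" "f r = f s" "r \<noteq> s"
    \<comment> \<open>A block through two points of \<open>X\<close> is \<open>X\<close> itself,
      which contradicts \<open>p\<close> lying on \<open>f r\<close> but not on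
      \<open>X\<close>.\<close>
    then have "f r = X" using uniq[of "f r" X r s] f[of r] f[of s] sub X by auto
    then show False using f[of r] rs X by auto
  qed
  moreover have "f ` (X \<inter> P' - L) = ?C"
  proof (intro subset_antisym subsetI)
    fix B assume "B \<in> f ` (X \<inter> P' - L)"
    then obtain r where r: "r \<in> X \<inter> P' - L" "B = f r" by blast
    have "q \<notin> B" using uniq[of B L p q] f[OF r(1)] r L sub \<open>p \<noteq> q\<close> by blast
    then show "B \<in> ?C" using f[OF r(1)] r by auto
  next
    fix B assume "B \<in> ?C"
    then obtain r where r: "B \<in> Bs'" "p \<in> B" "q \<notin> B" "r \<in> B" "r \<in> X" by blast
    have "r \<noteq> p" using r X by auto
    have "r \<in> P'" using r steiner_designD(3)[OF D'] by blast
    moreover have "r \<notin> L" using uniq[of B L p r] r L sub \<open>r \<noteq> p\<close> by blast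
    ultimately have m: "r \<in> X \<inter> P' - L" using r by blast
    have "f r = B" using uniq[of "f r" B p r] f[OF m] r sub \<open>r \<noteq> p\<close> by blast
    with m show "B \<in> f ` (X \<inter> P' - L)" by blast
  qed
  ultimately show ?thesis by (metis card_image)
qed

lemma neighbourhood_induce_subgraph:
  "x \<in> C \<Longrightarrow> neighbourhood (block_graph Bs \<restriction> C) x = neighbourhood (block_graph Bs) x \<inter> C"
  by (auto simp: neighbourhood_def block_graph_def induce_subgraph_def arcs_ends_def arc_to_ends_def)

text \<open>Reduces the regularity conditions to counts of neighbours in the whole block
  graph.\<close>

lemma regular_of_degree_induce_subgraph:
  "regular_of_degree (block_graph Bs \<restriction> C) k \<longleftrightarrow>
     (\<forall>x\<in>C. card (neighbourhood (block_graph Bs) x \<inter> C) = k)"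
  by (simp add: regular_of_degree_def neighbourhood_induce_subgraph)

theorem theorem4:
  fixes v v' b :: nat
    and P P' :: "'p set" and Bs Bs' :: "'p set set"
    and p1 p2 :: 'p
  assumes "b \<ge> 2"
    and "steiner_design v b P Bs"
    and "subdesign v' b P' Bs' P Bs"
    and "p1 \<in> P'" and "p2 \<in> P'" and "p1 \<noteq> p2"
  shows "switching_set (block_graph Bs)
           {B \<in> Bs'. p1 \<in> B \<and> p2 \<notin> B}
           {B \<in> Bs'. p2 \<in> B \<and> p1 \<notin> B}"
proof -
  let ?N = "neighbourhood (block_graph Bs)"
  \<comment> \<open>With both points as parameters, each fact below serves both pencils.\<close>
  define C where "C p q = {B \<in> Bs'. p \<in> B \<and> q \<notin> B}" for p q
  have sub: "Bs' \<subseteq> Bs" and D': "steiner_design v' b P' Bs'"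
    using assms(3) by (auto simp: subdesign_def)
  have finC: "finite (C p q)" for p q
    using steiner_designD(2)[OF D'] by (simp add: C_def)
  obtain L where L: "L \<in> Bs'" "p1 \<in> L" "p2 \<in> L"
    using steiner_design_block_ex[OF D'] assms by metis
  note uniq = steiner_design_block_unique[OF assms(2)]
  \<comment> \<open>Since \<open>X\<close> misses \<open>p\<close>, it is not in the pencil, so
    adjacency to a member just means meeting it.\<close>
  have N: "?N X \<inter> C p q = {B \<in> Bs'. p \<in> B \<and> q \<notin> B \<and> X \<inter> B \<noteq> {}}"
    if "X \<in> Bs" "p \<notin> X" for X p q
    using that sub by (auto simp: neighbourhood_block_graph C_def)
  have cross: "card (?N X \<inter> C p q) = card (X \<inter> P' - L)"
    if "X \<in> Bs" "p \<notin> X" "p \<in> L" "q \<in> L" "p \<noteq> q" for X p q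
    using pencil_meeting_card[OF assms(2,3) L(1), of p q X] N that by simp
  have clique: "card (?N X \<inter> C p q) = card (C p q) - 1" if "X \<in> C p q" for X p q
  proof -
    have "?N X \<inter> C p q = C p q - {X}"
      using that sub by (auto simp: neighbourhood_block_graph C_def)
    then show ?thesis using that finC by simp
  qed
  have "card (C p1 p2) * (b - 1) = card (C p2 p1) * (b - 1)"
    using pencil_partition_card[OF D' L(1), of p1 p2] pencil_partition_card[OF D' L(1), of p2 p1]
      L assms by (simp add: C_def)
  \<comment> \<open>The factor \<open>b - 1\<close> cancels because \<open>b\<close> is at least
    2.\<close>
  then have card_eq: "card (C p1 p2) = card (C p2 p1)"
    using assms(1) by simp
  \<comment> \<open>The first summand counts the rest of the clique of \<open>X\<close>. The second
    counts blocks of the other pencil, one for each point of \<open>X\<close> other than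
    \<open>p\<close>, since \<open>X\<close> meets \<open>L\<close> only in
    \<open>p\<close>.\<close>
  have deg: "card (?N X \<inter> (C p q \<union> C q p)) = card (C p q) - 1 + (b - 1)"
    if X: "X \<in> C p q" and pq: "p \<in> L" "q \<in> L" "p \<noteq> q" for X p q
  proof -
    have X': "X \<in> Bs" "X \<in> Bs'" "p \<in> X" "q \<notin> X" using X sub by (auto simp: C_def)
    have "X \<subseteq> P'" using steiner_designD(3)[OF D'] X' by blast
    moreover have "X \<inter> L = {p}"
      using uniq[of X L p] X' L sub pq by blast
    ultimately have "X \<inter> P' - L = X - {p}" by blast
    then have "card (X \<inter> P' - L) = b - 1"
      using steiner_designD(4)[OF D'] X' by simp
    moreover have "card (?N X \<inter> (C p q \<union> C q p)) = card (?N X \<inter> C p q) + card (?N X \<inter> C q p)"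
      by (simp add: Int_Un_distrib) (rule card_Un_disjoint; use finC in \<open>auto simp: C_def\<close>)
    ultimately show ?thesis using clique[OF X] cross[of X q p] X' pq by simp
  qed
  have outside: "?N X \<inter> (C p q \<union> C q p) = C p q"
    if X: "X \<in> Bs" "X \<notin> C p q" "p \<in> X" "q \<notin> X" and p: "p \<in> P'" for X p q
  proof -
    \<comment> \<open>A subdesign block through \<open>p\<close> that avoids \<open>q\<close> would
      belong to \<open>C p q\<close>.\<close>
    have nX: "X \<notin> Bs'" using X by (auto simp: C_def)
    have "r = p" if "r \<in> X" "r \<in> P'" for r
      using subdesign_block_mem[OF assms(2,3), of X p r] that X p nX by blast
    moreover have "B \<subseteq> P'" if "B \<in> Bs'" for B using steiner_designD(3)[OF D' that] .
    ultimately have "X \<inter> B = {}" if "B \<in> C q p" for B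
      using that by (fastforce simp: C_def)
    then show ?thesis using X nX sub by (auto simp: neighbourhood_block_graph C_def)
  qed
  have rest: "card (?N X \<inter> C p1 p2) = card (?N X \<inter> C p2 p1) \<or>
      ?N X \<inter> (C p1 p2 \<union> C p2 p1) \<in> {C p1 p2, C p2 p1}"
    if X: "X \<in> Bs" "X \<notin> C p1 p2" "X \<notin> C p2 p1" for X
  proof -
    consider "p1 \<in> X" "p2 \<in> X" | "p1 \<in> X" "p2 \<notin> X" | "p1 \<notin> X" "p2 \<in> X" | "p1 \<notin> X" "p2 \<notin> X"
      by blast
    then show ?thesis
    proof cases
      \<comment> \<open>Here \<open>X\<close> is \<open>L\<close>, which is adjacent to every member
        of both pencils.\<close>
      case 1
      then have "?N X \<inter> C p1 p2 = C p1 p2" "?N X \<inter> C p2 p1 = C p2 p1"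
        using X sub by (auto simp: neighbourhood_block_graph C_def)
      then show ?thesis using card_eq by simp
    next
      case 2
      then show ?thesis using outside[of X p1 p2] X assms by simp
    next
      case 3
      then show ?thesis using outside[of X p2 p1] X assms by (simp add: Un_commute)
    next
      \<comment> \<open>Both counts equal \<open>card (X \<inter> P' - L)\<close>.\<close>
      case 4
      then show ?thesis using cross[of X p1 p2] cross[of X p2 p1] X L assms by simp
    qed
  qed
  have "switching_set (block_graph Bs) (C p1 p2) (C p2 p1)"
    unfolding switching_set_def regular_of_degree_induce_subgraph
  proof (intro conjI)
    show "graph (block_graph Bs)"
      by (rule graph_block_graph) (rule steiner_designD(2)[OF assms(2)])
    show "C p1 p2 \<subseteq> verts (block_graph Bs)" "C p2 p1 \<subseteq> verts (block_graph Bs)"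
      using sub by (auto simp: block_graph_def C_def)
    show "C p1 p2 \<inter> C p2 p1 = {}" by (auto simp: C_def)
    show "card (C p1 p2) = card (C p2 p1)" by (rule card_eq)
    show "\<exists>k. (\<forall>X\<in>C p1 p2. card (?N X \<inter> C p1 p2) = k) \<and> (\<forall>X\<in>C p2 p1. card (?N X \<inter> C p2 p1) = k)"
      using clique card_eq by metis
    show "\<exists>k. \<forall>X\<in>C p1 p2 \<union> C p2 p1. card (?N X \<inter> (C p1 p2 \<union> C p2 p1)) = k"
      \<comment> \<open>The degree has the same form for both pencils, so \<open>card_eq\<close>
        makes one witness fit all of the union.\<close>
      using deg[of _ p1 p2] deg[of _ p2 p1] L assms(6) card_eq
      by (intro exI[of _ "card (C p1 p2) - 1 + (b - 1)"]) (auto simp: Un_commute)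
    show "\<forall>X\<in>verts (block_graph Bs) - (C p1 p2 \<union> C p2 p1).
        card (?N X \<inter> C p1 p2) = card (?N X \<inter> C p2 p1) \<or>
        ?N X \<inter> (C p1 p2 \<union> C p2 p1) \<in> {C p1 p2, C p2 p1}"
      using rest by (auto simp: block_graph_def)
  qed
  then show ?thesis unfolding C_def .
qed

end
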